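(* Let $X$ be a positive componentwise solution of the system $$X_0(t)=0,\qquad \dot{X}_n(t)=k_{n-1}X_{n-1}^2(t)-k_nX_n(t)X_{n+1}(t)\quad (t\ge 0,\ n\ge 1),\qquad k_n=2^n,$$ with $X(0)\in l^{\infty}\cap\mathbb{R}_{+}^{\mathbb{N}}$. Then there exists $C>0$ such that $$|X(t)|_H^2\le\frac{C}{t^2}\qquad\text{for all } t\ge1.$$
   Context: $\mathbb{R}_+^{\mathbb{N}}$ is the set of sequences $(x_n)_{n\ge1}$ of non-negative real numbers; $l^\infty$ is the space of bounded real sequences; $|x|_H^2=\sum_{n\ge1}x_n^2$ is the squared norm of $H=l^2$. A componentwise solution with initial condition $X^0\in\mathbb{R}^{\mathbb{N}}$ is a sequence $X=(X_n(\cdot))_{n\ge1}$ of continuously differentiable functions $X_n:[0,\infty)\to\mathbb{R}$ with $X_n(0)=X^0_n$ for all $n\ge1$, satisfying all equations of the system. It is positive if $X_n(t)\ge0$ for all $n\ge1$, $t\ge0$. *)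

theory Defs
  imports "HOL-Analysis.Analysis"
begin

text \<open>Sequences \<open>(x\<^sub>n)\<close> with \<open>n \<ge> 1\<close> are functions on \<^typ>\<open>nat\<close> whose
  value at index 0 is irrelevant, so every notion below is restricted to indices \<open>n \<ge> 1\<close>.\<close>

definition nonneg_seqs :: "(nat \<Rightarrow> real) set" where
  "nonneg_seqs = {x. \<forall>n\<ge>1. 0 \<le> x n}"

definition linf :: "(nat \<Rightarrow> real) set" where
  "linf = {x. bounded (x ` {1..})}"

definition H :: "(nat \<Rightarrow> real) set" where
  "H = {x. (\<lambda>n. (x n)\<^sup>2) summable_on {1..}}"

text \<open>Meaningful only for members of \<^const>\<open>H\<close>: an infinite sum that diverges
  has the value 0.\<close>
definition H_norm_sq :: "(nat \<Rightarrow> real) \<Rightarrow> real" where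
  "H_norm_sq x = (\<Sum>\<^sub>\<infinity>n\<in>{1..}. (x n)\<^sup>2)"

definition k :: "nat \<Rightarrow> real" where
  "k n = 2 ^ n"

text \<open>Derivatives on \<open>[0, \<infinity>)\<close> are one-sided at 0 and two-sided elsewhere.\<close>
definition C1_on_halfline :: "(real \<Rightarrow> real) \<Rightarrow> bool" where
  "C1_on_halfline f \<longleftrightarrow>
     (\<exists>f'. continuous_on {0..} f' \<and>
           (\<forall>t\<ge>0. (f has_real_derivative f' t) (at t within {0..})))"

text \<open>\<open>X n t\<close> is the \<open>n\<close>-th component at time \<open>t\<close>; only \<open>t \<ge> 0\<close> matters.
  Index 0 carries the boundary component, which vanishes identically.\<close>
definition componentwise_solution ::
    "(nat \<Rightarrow> real) \<Rightarrow> (nat \<Rightarrow> real \<Rightarrow> real) \<Rightarrow> bool" where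
  "componentwise_solution x0 X \<longleftrightarrow>
     (\<forall>n\<ge>1. C1_on_halfline (X n)) \<and>
     (\<forall>n\<ge>1. X n 0 = x0 n) \<and>
     (\<forall>t\<ge>0. X 0 t = 0) \<and>
     (\<forall>n\<ge>1. \<forall>t\<ge>0.
        (X n has_real_derivative
           k (n - 1) * (X (n - 1) t)\<^sup>2 - k n * X n t * X (n + 1) t) (at t within {0..}))"

definition positive_solution :: "(nat \<Rightarrow> real \<Rightarrow> real) \<Rightarrow> bool" where
  "positive_solution X \<longleftrightarrow> (\<forall>n\<ge>1. \<forall>t\<ge>0. 0 \<le> X n t)"

end

theory Submission
  imports Defs "HOL-Real_Asymp.Real_Asymp"
begin

text \<open>The truncated functional
  \<open>\<Phi>\<^sub>N = (\<Sum>n=1..N. (1 + q\<^sup>n) X\<^sub>n\<^sup>2) - 1/5 (\<Sum>n=1..N. q\<^sup>n X\<^sub>n X\<^sub>n\<^sub>+\<^sub>1)\<close> with \<open>q = 2/3\<close> is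
  comparable to the energy of the first \<open>N\<close> modes. Because the weights \<open>1 + q\<^sup>n\<close> decrease, the
  energy flux contributes the dissipation \<open>- (\<Sum>n. (2q)\<^sup>n X\<^sub>n\<^sup>2 X\<^sub>n\<^sub>+\<^sub>1)\<close>; the products
  \<open>X\<^sub>n X\<^sub>n\<^sub>+\<^sub>1\<close> contribute \<open>- (\<Sum>n. (2q)\<^sup>n X\<^sub>n\<^sup>3)\<close> and terms absorbed by the two dissipations.
  Since \<open>2q > 1\<close>, the cubic sum dominates \<open>\<lambda>\<Phi>\<^sub>N - c\<lambda>\<^sup>3\<close> for every \<open>\<lambda> > 0\<close>, and \<open>\<lambda> \<sim> 1/t\<close> gives
  \<open>\<Phi>\<^sub>N \<le> C/t\<^sup>2\<close> up to the truncation error. That error is of order \<open>(2q\<^sup>2)\<^sup>N\<close> times a power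
  of \<open>N\<close>, because the truncated energies are nonincreasing, so that \<open>X\<^sub>N\<close> grows at most
  polynomially in \<open>N\<close>. It vanishes as \<open>N \<rightarrow> \<infinity>\<close> because \<open>2q\<^sup>2 < 1\<close>.\<close>

section \<open>The truncated functional and its formal derivative\<close>

definition drift :: "(nat \<Rightarrow> real) \<Rightarrow> nat \<Rightarrow> real" where
  "drift x n = k (n - 1) * (x (n - 1))\<^sup>2 - k n * x n * x (n + 1)"

definition lyap :: "nat \<Rightarrow> (nat \<Rightarrow> real) \<Rightarrow> real" where
  "lyap N x = (\<Sum>n=1..N. (1 + (2/3)^n) * (x n)\<^sup>2) - 1/5 * (\<Sum>n=1..N. (2/3)^n * (x n * x (n + 1)))"

text \<open>The derivative of \<open>lyap N\<close> along the flow, as a function of the state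
  alone, so that it can be estimated purely algebraically.\<close>

definition lyap_drift :: "nat \<Rightarrow> (nat \<Rightarrow> real) \<Rightarrow> real" where
  "lyap_drift N x = (\<Sum>n=1..N. (1 + (2/3)^n) * (2 * x n * drift x n))
     - 1/5 * (\<Sum>n=1..N. (2/3)^n * (drift x n * x (n + 1) + x n * drift x (n + 1)))"

section \<open>Elementary inequalities\<close>

lemma sum_shift_le:
  fixes f :: "nat \<Rightarrow> real"
  assumes "\<And>n. f n \<ge> 0"
  shows "(\<Sum>n=1..M. f (n + j)) \<le> (\<Sum>n=1..M + j. f n)"
proof -
  have "(\<Sum>n=1..M. f (n + j)) = (\<Sum>n=1 + j..M + j. f n)"
    by (rule sum.shift_bounds_cl_nat_ivl [symmetric])
  also have "\<dots> \<le> (\<Sum>n=1..M + j. f n)"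
    by (rule sum_mono2) (use assms in auto)
  finally show ?thesis .
qed

text \<open>Weighted Young inequality by completing a square; the weight \<open>c\<close> is chosen
  at each use to balance the two dissipations.\<close>

lemma mult_sq_le:
  fixes x y c :: real
  assumes "y \<ge> 0" "c > 0"
  shows "x * y\<^sup>2 \<le> c * x\<^sup>2 * y + y ^ 3 / (4 * c)"
proof -
  have "0 \<le> y * (2 * c * x - y)\<^sup>2 / (4 * c)"
    using assms by simp
  also have "\<dots> = c * x\<^sup>2 * y + y ^ 3 / (4 * c) - x * y\<^sup>2"
    using assms by (simp add: field_simps power2_eq_square power3_eq_cube)
  finally show ?thesis by simp
qed

lemma mult3_le:
  fixes x y z c :: real
  assumes "y \<ge> 0" "c > 0"
  shows "x * y * z \<le> c * x\<^sup>2 * y + y * z\<^sup>2 / (4 * c)"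
proof -
  have "0 \<le> y * (2 * c * x - z)\<^sup>2 / (4 * c)"
    using assms by simp
  also have "\<dots> = c * x\<^sup>2 * y + y * z\<^sup>2 / (4 * c) - x * y * z"
    using assms by (simp add: field_simps power2_eq_square)
  finally show ?thesis by simp
qed

section \<open>Dissipation estimates\<close>

text \<open>The gain of mode \<open>n + 1\<close> is the loss of mode \<open>n\<close>, so the sum
  telescopes to the flux out of mode \<open>N\<close>.\<close>

lemma energy_drift:
  assumes "x 0 = 0"
  shows "(\<Sum>n=1..N. 2 * x n * drift x n) = - 2 * k N * (x N)\<^sup>2 * x (N + 1)"
  using assms by (induction N) (simp_all add: drift_def algebra_simps power2_eq_square)

text \<open>Summation by parts: each flux is multiplied by the weight drop
  \<open>(2/3)^n / 3\<close>, and \<open>2 * k n\<close> times this is \<open>2/3 * (4/3)^n\<close>.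
  Keeping \<open>n = N\<close> in the sum leaves the boundary weight with index
  \<open>N + 1\<close>.\<close>

lemma weighted_energy_drift:
  assumes "x 0 = 0"
  shows "(\<Sum>n=1..N. (1 + (2/3)^n) * (2 * x n * drift x n))
     = - (2/3) * (\<Sum>n=1..N. (4/3)^n * (x n)\<^sup>2 * x (n + 1))
       - 2 * (1 + (2/3)^(N + 1)) * k N * (x N)\<^sup>2 * x (N + 1)"
proof (induction N)
  case 0
  then show ?case using assms by simp
next
  case (Suc N)
  have "(4/3::real)^Suc N = (2/3)^Suc N * k (Suc N)"
    unfolding k_def power_mult_distrib [symmetric] by simp
  then show ?case
    using Suc by (simp add: drift_def algebra_simps power2_eq_square)
qed

text \<open>The feed of mode \<open>n + 1\<close> by mode \<open>n\<close> supplies the cubic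
  dissipation. The feed of mode \<open>n\<close> has a favourable sign and is dropped. The factor 2
  is \<open>k (n + 1) / k n\<close>.\<close>

lemma pair_drift_le:
  assumes "\<And>n. x n \<ge> 0"
  shows "- ((2/3)^n * (drift x n * x (n + 1) + x n * drift x (n + 1)))
    \<le> (4/3)^n * (x n * (x (n + 1))\<^sup>2) + 2 * (4/3)^n * (x n * x (n + 1) * x (n + 2)) - (4/3)^n * x n ^ 3"
proof -
  have *: "(4/3::real)^n = (2/3)^n * k n"
    unfolding k_def power_mult_distrib [symmetric] by simp
  have "0 \<le> (2/3)^n * (k (n - 1) * (x (n - 1))\<^sup>2 * x (n + 1))"
    using assms by (simp add: k_def)
  then show ?thesis
    unfolding * drift_def
    by (simp add: algebra_simps power2_eq_square power3_eq_cube k_def)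
qed

text \<open>The products of \<open>pair_drift_le\<close> are split between the flux and cubic
  dissipations. They reach two modes ahead, so the last two indices are treated separately and
  \<open>B\<close> bounds the two modes beyond the truncation.\<close>

lemma lyap_drift_le:
  fixes x :: "nat \<Rightarrow> real" and M :: nat
  defines "N \<equiv> M + 2"
  assumes nn: "\<And>n. x n \<ge> 0" and "x 0 = 0"
    and bd: "x (N + 1) \<le> B" "x (N + 2) \<le> B"
  shows "lyap_drift N x \<le> - 1/10 * (\<Sum>n=1..N. (4/3)^n * x n ^ 3) + (8/9)^N * B^3"
proof -
  define F where "F n = (4/3)^n * (x n)\<^sup>2 * x (n + 1)" for n
  define D where "D n = (4/3)^n * x n ^ 3" for n
  define T where "T n = (4/3)^n * (x n * (x (n + 1))\<^sup>2)" for n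
  define U where "U n = 2 * (4/3)^n * (x n * x (n + 1) * x (n + 2))" for n
  define P where "P = k N * (x N)\<^sup>2 * x (N + 1)"
  define e where "e = (8/9)^N * B^3"
  have F0: "F n \<ge> 0" and D0: "D n \<ge> 0" for n
    using nn by (simp_all add: F_def D_def)
  have P0: "P \<ge> 0" using nn by (simp add: P_def k_def)
  have B0: "B \<ge> 0" using bd(1) nn[of "N+1"] by linarith
  then have e0: "e \<ge> 0" by (simp add: e_def)
  have T_le: "T n \<le> 1/4 * D (n + 1) + 3/4 * F n" for n
  proof -
    have "(4/3)^n * (x n * (x (n + 1))\<^sup>2)
        \<le> (4/3)^n * (3/4 * (x n)\<^sup>2 * x (n + 1) + x (n + 1) ^ 3 / (4 * (3/4)))"
      by (intro mult_left_mono mult_sq_le nn) auto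
    then show ?thesis by (simp add: T_def D_def F_def algebra_simps)
  qed
  \<comment> \<open>Young is applied twice, the second time to the remainder
    \<open>x (n + 1) * (x (n + 2))^2\<close>. Each index shift gains a factor 3/4 from the weights
    \<open>(4/3)^n\<close>.\<close>
  have U_le: "U n \<le> 2 * F n + 9/64 * D (n + 2) + 3/16 * F (n + 1)" for n
  proof -
    have "x n * x (n + 1) * x (n + 2)
        \<le> 1 * (x n)\<^sup>2 * x (n + 1) + x (n + 1) * (x (n + 2))\<^sup>2 / (4 * 1)"
      by (intro mult3_le nn) auto
    moreover have "x (n + 1) * (x (n + 2))\<^sup>2
        \<le> 1/2 * (x (n + 1))\<^sup>2 * x (n + 2) + x (n + 2) ^ 3 / (4 * (1/2))"
      by (intro mult_sq_le nn) auto
    ultimately have "2 * (4/3)^n * (x n * x (n + 1) * x (n + 2))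
        \<le> 2 * (4/3)^n * ((x n)\<^sup>2 * x (n + 1) + 1/8 * (x (n + 1))\<^sup>2 * x (n + 2) + 1/8 * x (n + 2) ^ 3)"
      by (intro mult_left_mono) (auto simp: algebra_simps)
    then show ?thesis by (simp add: U_def D_def F_def algebra_simps)
  qed
  have kN: "(4/3::real)^N = k N * (2/3)^N" and ke: "k N * ((2/3)^N * (2/3)^N) = (8/9::real)^N"
    unfolding k_def power_mult_distrib [symmetric] by simp_all
  have kN0: "k N \<ge> 0" by (simp add: k_def)
  define g :: real where "g = (2/3)^N"
  have g0: "g > 0" by (simp add: g_def)
  have cube: "a * b * c \<le> B^3" if "0 \<le> a" "0 \<le> b" "0 \<le> c" "a \<le> B" "b \<le> B" "c \<le> B" for a b c
    unfolding power3_eq_cube using that by (intro mult_mono) auto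
  have g_sq: "k N * (g\<^sup>2 * c) \<le> e" if "c \<le> B^3" for c
  proof -
    have "k N * (g\<^sup>2 * c) = (8/9)^N * c"
      using ke by (simp add: g_def power2_eq_square)
    also have "\<dots> \<le> e" unfolding e_def using that by (intro mult_left_mono) auto
    finally show ?thesis .
  qed
  have y3: "x (N + 1) ^ 3 \<le> B^3" and yz: "x (N + 1) * (x (N + 2))\<^sup>2 \<le> B^3"
    using cube[of "x (N+1)" "x (N+1)" "x (N+1)"] cube[of "x (N+1)" "x (N+2)" "x (N+2)"] nn bd
    by (simp_all add: power2_eq_square power3_eq_cube)
  \<comment> \<open>There is no cubic dissipation beyond index \<open>N\<close>. The last terms are absorbed by the flux
    \<open>P\<close> out of mode \<open>N\<close>, whose coefficient is larger than that of \<open>F N\<close> by \<open>1/g\<close>; balancing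
    with it leaves an error of order \<open>k N * g\<^sup>2\<close>.\<close>
  have edge: "(4/3)^N * (x N * (x (N + 1))\<^sup>2) \<le> P + 1/4 * e"
  proof -
    have "g * (x N * (x (N + 1))\<^sup>2) \<le> g * (1/g * (x N)\<^sup>2 * x (N + 1) + x (N + 1) ^ 3 / (4 * (1/g)))"
      using g0 by (intro mult_left_mono mult_sq_le nn) auto
    also have "\<dots> = (x N)\<^sup>2 * x (N + 1) + g\<^sup>2 * x (N + 1) ^ 3 / 4"
      using g0 by (simp add: field_simps power2_eq_square)
    finally have "k N * (g * (x N * (x (N + 1))\<^sup>2)) \<le> k N * ((x N)\<^sup>2 * x (N + 1) + g\<^sup>2 * x (N + 1) ^ 3 / 4)"
      using kN0 by (rule mult_left_mono)
    then show ?thesis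
      using g_sq[OF y3] by (simp add: kN P_def g_def algebra_simps)
  qed
  then have TN: "T N \<le> P + 1/4 * e" by (simp add: T_def)
  have UN: "U N \<le> P + e"
  proof -
    have "2 * g * (x N * x (N + 1) * x (N + 2))
        \<le> 2 * g * (1/(2*g) * (x N)\<^sup>2 * x (N + 1) + x (N + 1) * (x (N + 2))\<^sup>2 / (4 * (1/(2*g))))"
      using g0 by (intro mult_left_mono mult3_le nn) auto
    also have "\<dots> = (x N)\<^sup>2 * x (N + 1) + g\<^sup>2 * (x (N + 1) * (x (N + 2))\<^sup>2)"
      using g0 by (simp add: field_simps power2_eq_square)
    finally have "k N * (2 * g * (x N * x (N + 1) * x (N + 2)))
        \<le> k N * ((x N)\<^sup>2 * x (N + 1) + g\<^sup>2 * (x (N + 1) * (x (N + 2))\<^sup>2))"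
      using kN0 by (rule mult_left_mono)
    then show ?thesis
      using g_sq[OF yz] by (simp add: U_def kN P_def g_def algebra_simps)
  qed
  \<comment> \<open>Here \<open>U_le\<close> would produce \<open>D (N + 1)\<close>, which lies
    outside the sum; one application of Young leaves the term bounded in \<open>edge\<close>
    instead.\<close>
  have U1: "U (M + 1) \<le> 2 * F (M + 1) + P + e"
  proof -
    have N1: "N = Suc (Suc M)" by (simp add: N_def)
    have "x (M + 1) * x N * x (N + 1)
        \<le> 1 * (x (M + 1))\<^sup>2 * x N + x N * (x (N + 1))\<^sup>2 / (4 * 1)"
      by (intro mult3_le nn) auto
    then have "2 * (4/3)^(M+1) * (x (M + 1) * x N * x (N + 1))
        \<le> 2 * (4/3)^(M+1) * ((x (M + 1))\<^sup>2 * x N + 1/4 * (x N * (x (N + 1))\<^sup>2))"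
      by (intro mult_left_mono) auto
    then have "U (M + 1) \<le> 2 * F (M + 1) + 3/8 * ((4/3)^N * (x N * (x (N + 1))\<^sup>2))"
      by (simp add: U_def F_def N1 algebra_simps)
    then show ?thesis using edge P0 e0 by linarith
  qed
  have S1: "sum T {1..N} \<le> 1/4 * sum D {1..N} + 3/4 * sum F {1..N} + P + 1/4 * e"
  proof -
    have "sum T {1..M+1} \<le> (\<Sum>n=1..M+1. 1/4 * D (n + 1) + 3/4 * F n)"
      by (intro sum_mono T_le)
    also have "\<dots> = 1/4 * (\<Sum>n=1..M+1. D (n + 1)) + 3/4 * sum F {1..M+1}"
      by (simp only: sum.distrib sum_distrib_left)
    also have "\<dots> \<le> 1/4 * sum D {1..N} + 3/4 * sum F {1..N}"
    proof -
      have "N = M + 1 + 1" by (simp add: N_def)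
      then have "(\<Sum>n=1..M+1. D (n + 1)) \<le> sum D {1..N}"
        using sum_shift_le[of D 1 "M+1", OF D0] by simp
      moreover have "sum F {1..M+1} \<le> sum F {1..N}"
        by (rule sum_mono2) (auto simp: N_def F0)
      ultimately show ?thesis by linarith
    qed
    finally show ?thesis using TN by (simp add: N_def)
  qed
  have S2: "sum U {1..N} \<le> 35/16 * sum F {1..N} + 9/64 * sum D {1..N} + 2 * P + 2 * e"
  proof -
    have "sum U {1..M} \<le> (\<Sum>n=1..M. 2 * F n + 9/64 * D (n + 2) + 3/16 * F (n + 1))"
      by (intro sum_mono U_le)
    also have "\<dots> = 2 * sum F {1..M} + 9/64 * (\<Sum>n=1..M. D (n + 2)) + 3/16 * (\<Sum>n=1..M. F (n + 1))"
      by (simp only: sum.distrib sum_distrib_left)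
    also have "\<dots> \<le> 2 * sum F {1..M} + 9/64 * sum D {1..N} + 3/16 * sum F {1..M+1}"
      using sum_shift_le[of D 2 M, OF D0] sum_shift_le[of F 1 M, OF F0] unfolding N_def by linarith
    finally have "sum U {1..M} \<le> \<dots>" .
    moreover have "sum U {1..N} = sum U {1..M} + U (M + 1) + U N"
        "sum F {1..N} = sum F {1..M} + F (M + 1) + F N"
        "sum F {1..M+1} = sum F {1..M} + F (M + 1)"
      by (simp_all add: N_def)
    ultimately show ?thesis using UN U1 F0[of N] by linarith
  qed
  have pairs: "- (\<Sum>n=1..N. (2/3)^n * (drift x n * x (n + 1) + x n * drift x (n + 1)))
      \<le> sum T {1..N} + sum U {1..N} - sum D {1..N}"
    unfolding sum_negf [symmetric] sum.distrib [symmetric] sum_subtractf [symmetric]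
    by (rule sum_mono) (use pair_drift_le[OF nn] in \<open>simp only: T_def U_def D_def\<close>)
  have energy: "(\<Sum>n=1..N. (1 + (2/3)^n) * (2 * x n * drift x n)) \<le> - (2/3) * sum F {1..N} - 2 * P"
  proof -
    have "0 \<le> (2/3)^(N+1) * P" using P0 by simp
    then show ?thesis
      unfolding weighted_energy_drift[of x, OF \<open>x 0 = 0\<close>]
      by (simp add: F_def P_def algebra_simps)
  qed
  have "sum F {1..N} \<ge> 0" "sum D {1..N} \<ge> 0" by (simp_all add: sum_nonneg F0 D0)
  \<comment> \<open>The factor 1/5 makes the budget close: \<open>F\<close> costs (3/4 + 35/16)/5 =
    47/80 < 2/3, \<open>D\<close> keeps (1 - 1/4 - 9/64)/5 = 39/320 > 1/10, \<open>P\<close> costs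
    3/5 < 2 and \<open>e\<close> enters with 9/20 < 1.\<close>
  then have "lyap_drift N x \<le> - 1/10 * sum D {1..N} + e"
    unfolding lyap_drift_def using energy pairs S1 S2 P0 e0 by argo
  then show ?thesis by (simp add: D_def e_def)
qed

section \<open>Comparison with the truncated energy\<close>

text \<open>Threshold argument: a mode with \<open>(4/3)^n * x n\<close> at least \<open>l\<close>
  is controlled by its cubic term; any other is below \<open>l * (3/4)^n\<close>, which contributes
  a convergent geometric series.\<close>

lemma sum_cubes_ge:
  fixes x :: "nat \<Rightarrow> real"
  assumes nn: "\<And>n. x n \<ge> 0" and l: "l > 0"
  shows "l * (\<Sum>n=1..N. (x n)\<^sup>2) \<le> (\<Sum>n=1..N. (4/3)^n * x n ^ 3) + 3 * l^3"
proof -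
  have *: "l * (x n)\<^sup>2 \<le> (4/3)^n * x n ^ 3 + l^3 * (9/16)^n" for n
  proof (cases "l \<le> (4/3)^n * x n")
    case True
    then have "l * (x n)\<^sup>2 \<le> (4/3)^n * x n * (x n)\<^sup>2"
      by (rule mult_right_mono) simp
    moreover have "0 \<le> l^3 * (9/16)^n" using l by simp
    ultimately show ?thesis by (simp add: power2_eq_square power3_eq_cube mult.assoc)
  next
    case False
    then have "(3/4)^n * ((4/3)^n * x n) \<le> (3/4)^n * l"
      by (intro mult_left_mono) auto
    then have "x n \<le> l * (3/4)^n"
      by (simp add: mult.commute [of l] flip: mult.assoc power_mult_distrib)
    then have "(x n)\<^sup>2 \<le> (l * (3/4)^n)\<^sup>2"
      using nn by (intro power_mono) auto
    also have "\<dots> = l\<^sup>2 * (9/16)^n"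
    proof -
      have "((3/4::real)^n)\<^sup>2 = (9/16)^n"
        by (simp add: power2_eq_square flip: power_mult_distrib)
      then show ?thesis by (simp add: power_mult_distrib)
    qed
    finally have "l * (x n)\<^sup>2 \<le> l * (l\<^sup>2 * (9/16)^n)"
      using l by (intro mult_left_mono) auto
    moreover have "0 \<le> (4/3)^n * x n ^ 3" using nn by simp
    ultimately show ?thesis by (simp add: power2_eq_square power3_eq_cube mult.assoc)
  qed
  have "(\<Sum>n=1..N. (9/16::real)^n) \<le> (\<Sum>n\<in>{..<Suc N}. (9/16)^n)"
    by (rule sum_mono2) auto
  \<comment> \<open>The full series sums to 16/7.\<close>
  also have "\<dots> \<le> 3"
    by (simp only: sum_gp_strict) (simp add: field_simps)
  finally have g: "l^3 * (\<Sum>n=1..N. (9/16::real)^n) \<le> l^3 * 3"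
    using l by (intro mult_left_mono) auto
  have "l * (\<Sum>n=1..N. (x n)\<^sup>2) \<le> (\<Sum>n=1..N. (4/3)^n * x n ^ 3 + l^3 * (9/16)^n)"
    unfolding sum_distrib_left by (intro sum_mono *)
  then show ?thesis using g by (simp add: sum.distrib sum_distrib_left)
qed

lemma lyap_upper:
  assumes nn: "\<And>n. x n \<ge> 0"
  shows "lyap N x \<le> 2 * (\<Sum>n=1..N. (x n)\<^sup>2)"
proof -
  have "(\<Sum>n=1..N. (1 + (2/3)^n) * (x n)\<^sup>2) \<le> (\<Sum>n=1..N. 2 * (x n)\<^sup>2)"
    by (intro sum_mono mult_right_mono) (auto simp: power_le_one)
  moreover have "0 \<le> (\<Sum>n=1..N. (2/3)^n * (x n * x (n + 1)))"
    using nn by (intro sum_nonneg) auto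
  ultimately show ?thesis unfolding lyap_def sum_distrib_left [symmetric] by linarith
qed

text \<open>Each square is charged at most one half by each of its two neighbouring products, so the
  products cost at most the energy plus a boundary term, and the factor 1/5 leaves 4/5.\<close>

lemma lyap_lower:
  assumes nn: "\<And>n. x n \<ge> 0"
  shows "4/5 * (\<Sum>n=1..N. (x n)\<^sup>2) \<le> lyap N x + (2/3)^N * (x (N + 1))\<^sup>2"
proof -
  have *: "(2/3::real)^n * (x n * x (n + 1)) \<le> 1/2 * (x n)\<^sup>2 + (2/3)^n * (1/2 * (x (n + 1))\<^sup>2)" for n
  proof -
    have "x n * x (n + 1) \<le> 1/2 * (x n)\<^sup>2 + 1/2 * (x (n + 1))\<^sup>2"
      using sum_squares_bound[of "x n" "x (n+1)"] by simp
    then have "(2/3::real)^n * (x n * x (n + 1)) \<le> (2/3)^n * (1/2 * (x n)\<^sup>2 + 1/2 * (x (n + 1))\<^sup>2)"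
      by (intro mult_left_mono) auto
    moreover have "(2/3::real)^n * (1/2 * (x n)\<^sup>2) \<le> 1 * (1/2 * (x n)\<^sup>2)"
      by (intro mult_right_mono) (auto simp: power_le_one)
    ultimately show ?thesis by (simp add: algebra_simps)
  qed
  have "(\<Sum>n=1..N. (2/3)^n * (x n * x (n + 1))) \<le> (\<Sum>n=1..N. (x n)\<^sup>2) + 1/2 * ((2/3)^N * (x (N + 1))\<^sup>2)"
  proof (induction N)
    case 0
    then show ?case by simp
  next
    case (Suc N)
    have "(2/3::real)^N * (x (N + 1))\<^sup>2 \<le> 1 * (x (N + 1))\<^sup>2"
      by (intro mult_right_mono) (auto simp: power_le_one)
    then show ?case using Suc *[of "Suc N"] by (simp add: algebra_simps)
  qed
  moreover have "(\<Sum>n=1..N. (x n)\<^sup>2) \<le> (\<Sum>n=1..N. (1 + (2/3)^n) * (x n)\<^sup>2)"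
    by (intro sum_mono) (simp add: algebra_simps)
  moreover have "0 \<le> (2/3)^N * (x (N + 1))\<^sup>2" by simp
  ultimately show ?thesis unfolding lyap_def by argo
qed

section \<open>Monotonicity in time and a priori bounds\<close>

text \<open>The sign is asked only for \<open>t > 0\<close>, since the estimate in
  \<open>lyap_decay\<close> divides by \<open>t\<close>.\<close>

lemma nonincreasing_halfline:
  fixes f :: "real \<Rightarrow> real"
  assumes der: "\<And>t. t \<ge> 0 \<Longrightarrow> (f has_real_derivative f' t) (at t within {0..})"
    and neg: "\<And>t. t > 0 \<Longrightarrow> f' t \<le> 0" and "t \<ge> 0"
  shows "f t \<le> f 0"
proof (cases "t = 0")
  case False
  have "continuous_on {0..} f"
    by (rule DERIV_continuous_on) (use der in auto)
  moreover have "(f has_real_derivative f' s) (at s)" if "s > 0" for s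
    using der[of s] that by (simp add: at_within_interior[of s "{0..}"] interior_real_atLeast)
  ultimately show ?thesis
    using False \<open>t \<ge> 0\<close> neg
    by (intro DERIV_nonpos_imp_decreasing_open[of 0 t f])
      (auto intro: continuous_on_subset)
qed simp

lemma solution_deriv:
  assumes "componentwise_solution x0 X" "n \<ge> 1" "t \<ge> 0"
  shows "(X n has_real_derivative drift (\<lambda>n. X n t) n) (at t within {0..})"
  using assms by (simp add: componentwise_solution_def drift_def)

text \<open>Modes up to \<open>N\<close> lose energy only through the nonnegative flux out of mode
  \<open>N\<close>. Bounded initial data may have infinite total energy, so the bound is taken for
  each truncation.\<close>

lemma partial_energy_le:
  assumes sol: "componentwise_solution x0 X" and nn: "\<And>n t. t \<ge> 0 \<Longrightarrow> X n t \<ge> 0" and "t \<ge> 0"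
  shows "(\<Sum>n=1..N. (X n t)\<^sup>2) \<le> (\<Sum>n=1..N. (x0 n)\<^sup>2)"
proof -
  have "(\<Sum>n=1..N. (X n t)\<^sup>2) \<le> (\<Sum>n=1..N. (X n 0)\<^sup>2)"
  proof (rule nonincreasing_halfline)
    fix t :: real assume "t \<ge> 0"
    show "((\<lambda>t. \<Sum>n=1..N. (X n t)\<^sup>2) has_real_derivative (\<Sum>n=1..N. 2 * X n t * drift (\<lambda>n. X n t) n))
        (at t within {0..})"
      by (auto intro!: derivative_eq_intros sum.cong solution_deriv[OF sol] \<open>t \<ge> 0\<close>)
  next
    fix t :: real assume t: "t > 0"
    then have "X 0 t = 0" using sol by (simp add: componentwise_solution_def)
    then show "(\<Sum>n=1..N. 2 * X n t * drift (\<lambda>n. X n t) n) \<le> 0"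
      using nn[of t] t by (subst energy_drift) (auto simp: k_def)
  qed fact
  also have "\<dots> = (\<Sum>n=1..N. (x0 n)\<^sup>2)"
    using sol by (intro sum.cong) (auto simp: componentwise_solution_def)
  finally show ?thesis .
qed

lemma component_le:
  assumes sol: "componentwise_solution x0 X" and nn: "\<And>n t. t \<ge> 0 \<Longrightarrow> X n t \<ge> 0"
    and b: "\<And>n. n \<ge> 1 \<Longrightarrow> \<bar>x0 n\<bar> \<le> b" and "b \<ge> 0" "t \<ge> 0" "1 \<le> n" "n \<le> N"
  shows "X n t \<le> b * N"
proof (rule power2_le_imp_le)
  have "(X n t)\<^sup>2 \<le> (\<Sum>i=1..n. (X i t)\<^sup>2)"
    by (rule member_le_sum) (use \<open>1 \<le> n\<close> in auto)
  also have "\<dots> \<le> (\<Sum>i=1..n. (x0 i)\<^sup>2)" by (rule partial_energy_le) fact+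
  also have "\<dots> \<le> (\<Sum>i=1..n. b\<^sup>2)"
    by (intro sum_mono abs_le_square_iff[THEN iffD1]) (use b \<open>b \<ge> 0\<close> in auto)
  also have "\<dots> = b\<^sup>2 * n" by simp
  \<comment> \<open>The crude bound by the square avoids roots; any polynomial growth in
    \<open>N\<close> suffices.\<close>
  also have "\<dots> \<le> b\<^sup>2 * (real N)\<^sup>2"
  proof (rule mult_left_mono)
    have "n * 1 \<le> N * N" using assms by (intro mult_le_mono) auto
    then show "real n \<le> (real N)\<^sup>2"
      unfolding power2_eq_square of_nat_mult [symmetric] of_nat_le_iff by simp
  qed simp
  finally show "(X n t)\<^sup>2 \<le> (b * N)\<^sup>2" by (simp add: power_mult_distrib)
qed (use \<open>b \<ge> 0\<close> in simp)

section \<open>Decay of the functional and removal of the truncation\<close>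

lemma lyap_decay:
  fixes X :: "nat \<Rightarrow> real \<Rightarrow> real" and M :: nat
  defines "N \<equiv> M + 2"
  assumes sol: "componentwise_solution x0 X" and nn: "\<And>n t. t \<ge> 0 \<Longrightarrow> X n t \<ge> 0"
    and bd: "\<And>t. t \<ge> 0 \<Longrightarrow> X (N + 1) t \<le> B" "\<And>t. t \<ge> 0 \<Longrightarrow> X (N + 2) t \<le> B"
    and "t > 0"
  shows "lyap N (\<lambda>n. X n t) \<le> 64800 / t\<^sup>2 + (8/9)^N * B^3 * t"
proof -
  define e where "e = (8/9)^N * B^3"
  define \<phi> where "\<phi> t = lyap N (\<lambda>n. X n t)" for t
  define \<phi>' where "\<phi>' t = lyap_drift N (\<lambda>n. X n t)" for t
  have "0 \<le> B" using bd(1)[of 0] nn[of 0 "N+1"] by linarith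
  then have e0: "e \<ge> 0" by (simp add: e_def)
  \<comment> \<open>Here 64800 = 3/10 * 60^3. Everything vanishes at time 0, so the initial value of
    \<open>\<phi>\<close> does not enter the bound.\<close>
  have "t^3 * \<phi> t - 64800 * t - e * t^4 \<le> 0^3 * \<phi> 0 - 64800 * 0 - e * 0^4"
  proof (rule nonincreasing_halfline)
    fix t :: real assume t: "t \<ge> 0"
    have "(\<phi> has_real_derivative \<phi>' t) (at t within {0..})"
      unfolding \<phi>_def \<phi>'_def lyap_def lyap_drift_def
      by (auto intro!: derivative_eq_intros sum.cong solution_deriv[OF sol] t simp: algebra_simps)
    then show "((\<lambda>t. t^3 * \<phi> t - 64800 * t - e * t^4) has_real_derivative
        3 * t^2 * \<phi> t + t^3 * \<phi>' t - 64800 - 4 * e * t^3) (at t within {0..})"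
      by (auto intro!: derivative_eq_intros simp: algebra_simps)
  next
    fix t :: real assume t: "t > 0"
    have n0: "X n t \<ge> 0" for n using nn t by simp
    have X0: "X 0 t = 0" using sol t by (simp add: componentwise_solution_def)
    have "\<phi>' t \<le> - 1/10 * (\<Sum>n=1..N. (4/3)^n * X n t ^ 3) + e"
      unfolding \<phi>'_def e_def N_def
      by (rule lyap_drift_le) (use n0 X0 bd t in \<open>auto simp: N_def\<close>)
    \<comment> \<open>\<open>60/t\<close> makes the decay rate of \<open>\<phi>\<close> equal to \<open>3/t\<close>, so that \<open>t^3\<close> is an integrating factor.\<close>
    moreover have "60/t * (\<Sum>n=1..N. (X n t)\<^sup>2) \<le> (\<Sum>n=1..N. (4/3)^n * X n t ^ 3) + 3 * (60/t)^3"
      by (rule sum_cubes_ge) (use n0 t in auto)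
    moreover have "60/t * (1/2 * \<phi> t) \<le> 60/t * (\<Sum>n=1..N. (X n t)\<^sup>2)"
      using lyap_upper[of "\<lambda>n. X n t" N] n0 t unfolding \<phi>_def
      by (intro mult_left_mono) auto
    ultimately have "\<phi>' t \<le> - 3/t * \<phi> t + 3/10 * (60/t)^3 + e" by argo
    then have "t^3 * \<phi>' t \<le> t^3 * (- 3/t * \<phi> t + 3/10 * (60/t)^3 + e)"
      using t by (intro mult_left_mono) auto
    also have "\<dots> = - 3 * t^2 * \<phi> t + 64800 + e * t^3"
      using t by (simp add: field_simps power2_eq_square power3_eq_cube)
    finally have "3 * t^2 * \<phi> t + t^3 * \<phi>' t - 64800 - e * t^3 \<le> 0" by simp
    moreover have "e * t^3 \<ge> 0" using e0 t by simp
    ultimately show "3 * t^2 * \<phi> t + t^3 * \<phi>' t - 64800 - 4 * e * t^3 \<le> 0" by linarith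
  qed (use \<open>t > 0\<close> in simp)
  moreover have "t^3 * (64800 / t\<^sup>2 + e * t) = 64800 * t + e * t^4"
    using \<open>t > 0\<close> by (simp add: field_simps power2_eq_square power3_eq_cube power4_eq_xxxx)
  ultimately have "t^3 * \<phi> t \<le> t^3 * (64800 / t\<^sup>2 + e * t)" by simp
  then show ?thesis using \<open>t > 0\<close> by (simp add: \<phi>_def e_def)
qed

text \<open>For fixed \<open>m\<close> the truncation level tends to infinity. The bound
  \<open>b\<close> enters only the vanishing error, so the constant 81000 = 5/4 * 64800 does not
  depend on the solution.\<close>

lemma partial_energy_decay:
  assumes sol: "componentwise_solution x0 X" and nn: "\<And>n t. t \<ge> 0 \<Longrightarrow> X n t \<ge> 0"
    and b: "\<And>n. n \<ge> 1 \<Longrightarrow> \<bar>x0 n\<bar> \<le> b" and "b \<ge> 0" "t > 0"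
  shows "(\<Sum>n=1..m. (X n t)\<^sup>2) \<le> 81000 / t\<^sup>2"
proof -
  \<comment> \<open>The truncation level is \<open>M + 2\<close>; \<open>M + 4\<close> is the
    highest mode that has to be bounded.\<close>
  define r where "r M = 64800 / t\<^sup>2 + b^3 * t * ((8/9)^(M + 2) * real (M + 4)^3)
      + b\<^sup>2 * ((2/3)^(M + 2) * (real (M + 4))\<^sup>2)" for M :: nat
  have "r \<longlonglongrightarrow> 64800 / t\<^sup>2 + 0 + 0"
  proof -
    have "(\<lambda>M::nat. (8/9::real)^(M + 2) * real (M + 4)^3) \<longlonglongrightarrow> 0"
      and "(\<lambda>M::nat. (2/3::real)^(M + 2) * real (M + 4)^2) \<longlonglongrightarrow> 0"
      by real_asymp+
    then show ?thesis unfolding r_def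
      by (intro tendsto_add tendsto_const tendsto_mult_right_zero)
  qed
  moreover have "4/5 * (\<Sum>n=1..m. (X n t)\<^sup>2) \<le> r M" if "M \<ge> m" for M
  proof -
    have B: "X n s \<le> b * real (M + 4)" if "s \<ge> 0" "1 \<le> n" "n \<le> M + 4" for n s
      by (rule component_le) (use assms that in auto)
    have "4/5 * (\<Sum>n=1..m. (X n t)\<^sup>2) \<le> 4/5 * (\<Sum>n=1..M + 2. (X n t)\<^sup>2)"
      using that by (intro mult_left_mono sum_mono2) auto
    also have "\<dots> \<le> lyap (M + 2) (\<lambda>n. X n t) + (2/3)^(M + 2) * (X (M + 2 + 1) t)\<^sup>2"
      using nn \<open>t > 0\<close> by (intro lyap_lower) simp
    also have "lyap (M + 2) (\<lambda>n. X n t) \<le> 64800 / t\<^sup>2 + (8/9)^(M + 2) * (b * real (M + 4))^3 * t"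
      by (rule lyap_decay[OF sol nn]) (use B \<open>t > 0\<close> in auto)
    also have "(2/3)^(M + 2) * (X (M + 2 + 1) t)\<^sup>2 \<le> (2/3)^(M + 2) * (b * real (M + 4))\<^sup>2"
      using B[of t "M + 2 + 1"] nn[of t "M + 2 + 1"] \<open>t > 0\<close>
      by (intro mult_left_mono power_mono) auto
    finally show ?thesis by (simp only: r_def power_mult_distrib mult_ac)
  qed
  ultimately have "4/5 * (\<Sum>n=1..m. (X n t)\<^sup>2) \<le> 64800 / t\<^sup>2 + 0 + 0"
    by (intro LIMSEQ_le_const) auto
  then show ?thesis by simp
qed

text \<open>Membership in \<open>H\<close> accompanies the bound because a divergent infinite sum
  has value 0, which would make the bound alone void.\<close>

lemma infsum_sq_le:
  assumes "\<And>m. (\<Sum>n=1..m. (x n)\<^sup>2) \<le> C"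
  shows "x \<in> H \<and> H_norm_sq x \<le> C"
proof -
  have fin: "(\<Sum>n\<in>A. (x n)\<^sup>2) \<le> C" if "finite A" "A \<subseteq> {1..}" for A
  proof -
    have "A \<subseteq> {1..Max (insert 0 A)}" using that by auto
    then have "(\<Sum>n\<in>A. (x n)\<^sup>2) \<le> (\<Sum>n=1..Max (insert 0 A). (x n)\<^sup>2)"
      by (intro sum_mono2) auto
    also have "\<dots> \<le> C" by (rule assms)
    finally show ?thesis .
  qed
  have "(\<lambda>n. (x n)\<^sup>2) summable_on {1..}"
    by (rule nonneg_bdd_above_summable_on) (auto intro!: bdd_aboveI2[where M = C] fin)
  then show ?thesis
    using fin by (auto simp: H_def H_norm_sq_def intro!: infsum_le_finite_sums)
qed

theorem theorem8:
  fixes X :: "nat \<Rightarrow> real \<Rightarrow> real" and x0 :: "nat \<Rightarrow> real"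
  assumes "componentwise_solution x0 X"
    and "positive_solution X"
    and "x0 \<in> linf \<inter> nonneg_seqs"
  shows "\<exists>C>0. \<forall>t\<ge>1. (\<lambda>n. X n t) \<in> H \<and> H_norm_sq (\<lambda>n. X n t) \<le> C / t\<^sup>2"
proof -
  obtain b where b: "\<And>n. n \<ge> 1 \<Longrightarrow> \<bar>x0 n\<bar> \<le> b"
    using assms(3) by (auto simp: linf_def bounded_iff)
  from b[of 1] have "b \<ge> 0" by simp
  have nn: "X n t \<ge> 0" if "t \<ge> 0" for n t
    using assms that by (cases "n = 0") (auto simp: componentwise_solution_def positive_solution_def)
  have "(\<lambda>n. X n t) \<in> H \<and> H_norm_sq (\<lambda>n. X n t) \<le> 81000 / t\<^sup>2" if "t \<ge> 1" for t
    by (intro infsum_sq_le partial_energy_decay[OF assms(1) nn b \<open>b \<ge> 0\<close>]) (use that in auto)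
  then show ?thesis by (intro exI[of _ 81000]) simp
qed

end
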